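(* Let $k\ge2$. For every instance of the MUHV problem with $k$ colors, the linear programming relaxation (LP-MUHV) is the same as the Lovász-extension relaxation (CP-Sub-ML) of the associated Sub-ML instance with set function $f(X)=w(\partial(X))$. That is, the two programs have the same feasible assignments $(y_j^i)_{v_j\in V,\,i\in C}$, and for every such assignment the minimum of $\sum_{j=1}^n w_jx_j$ over all $(x_j^i),(x_j)$ which together with $(y_j^i)$ are feasible for (LP-MUHV) equals $$\sum_{i=1}^k\hat f(\mathbf{y}_i),\qquad \mathbf{y}_i=(y_1^i,\dots,y_n^i).$$
   Context: **MUHV instance.** A finite undirected graph $G=(V,E)$, $V=\{v_1,\dots,v_n\}$, non-negative vertex weights $w_j=w(v_j)$, a color set $C=\{1,\dots,k\}$, and a partial vertex coloring $c$ with colors in $C$ in which every color is used on at least one vertex. The goal in the MUHV problem is to extend $c$ to all vertices minimizing the total weight of unhappy vertices (vertices whose color differs from that of at least one neighbor). **(LP-MUHV).** Minimize $\sum_{j=1}^n w_jx_j$ subject to: $\sum_{i=1}^k y_j^i=1$ for all $v_j\in V$; $y_j^i=1$ whenever $c(v_j)=i$; $x_j^i\ge y_j^i-y_h^i$ for all $v_j\in V$, $v_h\in N(v_j)$, $i\in C$; $x_j=\sum_{i=1}^k x_j^i$ for all $v_j\in V$; and $y_j^i,x_j^i,x_j\ge0$. Here $N(v_j)$ is the set of neighbors of $v_j$. **Set function.** For $X\subseteq V$, $\partial(X)$ is the set of vertices of $X$ with at least one neighbor outside $X$, $w(X)=\sum_{v\in X}w(v)$, $f(X)=w(\partial(X))$.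 **Lovász extension.** For $\mathbf{y}\in[0,1]^V$ with maximum coordinate $1$ and minimum coordinate $0$, let $\pi$ be a permutation with $1=y_{\pi_1}\ge\dots\ge y_{\pi_n}=0$ and set $\hat f(\mathbf{y})=\sum_{j=1}^{n-1}(y_{\pi_j}-y_{\pi_{j+1}})\,f(\{v_{\pi_1},\dots,v_{\pi_j}\})$. **(CP-Sub-ML)** for this instance. Minimize $\sum_{i=1}^k\hat f(\mathbf{y}_i)$ subject to $\sum_{i=1}^k y_j^i=1$ for all $v_j\in V$; $y_j^i=1$ whenever $c(v_j)=i$; $y_j^i\ge0$ for all $v_j\in V$, $i\in C$. *)

theory Defs
  imports Complex_Main "HOL-Library.Multiset" "Graph_Theory.Digraph"
begin

text \<open>
  Graphs are those of the locale \<^locale>\<open>graph\<close>: finite, loop-free, without parallel edges, an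
  undirected edge being a pair of opposite arcs. Colors are the numbers \<open>1, \<dots>, k\<close>, and a partial
  coloring is a partial map. Since no color may be unused, its range is the whole color set.
\<close>

locale muhv_instance = graph G for G :: "('a, 'b) pre_digraph" +
  fixes w :: "'a \<Rightarrow> real" and k :: nat and c :: "'a \<rightharpoonup> nat"
  assumes weight_nonneg: "v \<in> verts G \<Longrightarrow> 0 \<le> w v"
    and dom_coloring: "dom c \<subseteq> verts G"
    and ran_coloring: "ran c = {1..k}"

definition neighbors :: "('a, 'b) pre_digraph \<Rightarrow> 'a \<Rightarrow> 'a set" where
  "neighbors G v = {u. v \<rightarrow>\<^bsub>G\<^esub> u}"

definition boundary :: "('a, 'b) pre_digraph \<Rightarrow> 'a set \<Rightarrow> 'a set" where
  "boundary G X = {v \<in> X. \<exists>u \<in> neighbors G v. u \<notin> X}"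

definition boundary_weight :: "('a, 'b) pre_digraph \<Rightarrow> ('a \<Rightarrow> real) \<Rightarrow> 'a set \<Rightarrow> real" where
  "boundary_weight G w X = (\<Sum>v \<in> boundary G X. w v)"


text \<open>
  In both programs \<open>y i v\<close> is the variable written \<open>y\<close> with subscript \<open>v\<close> and superscript \<open>i\<close>, so
  that \<open>y i\<close> is the vector of the color \<open>i\<close>. Values at arguments that are not vertices or colors
  play no role. In the linear program, \<open>xc i v\<close> are the variables with a color index and \<open>x v\<close> those
  without.
\<close>

definition lp_muhv_feasible ::
  "('a, 'b) pre_digraph \<Rightarrow> nat \<Rightarrow> ('a \<rightharpoonup> nat) \<Rightarrow>
    (nat \<Rightarrow> 'a \<Rightarrow> real) \<Rightarrow> (nat \<Rightarrow> 'a \<Rightarrow> real) \<Rightarrow> ('a \<Rightarrow> real) \<Rightarrow> bool" where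
  "lp_muhv_feasible G k c y xc x \<longleftrightarrow>
    (\<forall>v \<in> verts G. (\<Sum>i = 1..k. y i v) = 1) \<and>
    (\<forall>v \<in> verts G. \<forall>i \<in> {1..k}. c v = Some i \<longrightarrow> y i v = 1) \<and>
    (\<forall>v \<in> verts G. \<forall>u \<in> neighbors G v. \<forall>i \<in> {1..k}. xc i v \<ge> y i v - y i u) \<and>
    (\<forall>v \<in> verts G. x v = (\<Sum>i = 1..k. xc i v)) \<and>
    (\<forall>v \<in> verts G. \<forall>i \<in> {1..k}. y i v \<ge> 0 \<and> xc i v \<ge> 0) \<and>
    (\<forall>v \<in> verts G. x v \<ge> 0)"

definition lp_muhv_objective :: "('a, 'b) pre_digraph \<Rightarrow> ('a \<Rightarrow> real) \<Rightarrow> ('a \<Rightarrow> real) \<Rightarrow> real" where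
  "lp_muhv_objective G w x = (\<Sum>v \<in> verts G. w v * x v)"


definition sorting_enum :: "'a set \<Rightarrow> ('a \<Rightarrow> real) \<Rightarrow> (nat \<Rightarrow> 'a) \<Rightarrow> bool" where
  "sorting_enum V y \<pi> \<longleftrightarrow>
    bij_betw \<pi> {1..card V} V \<and>
    y (\<pi> 1) = 1 \<and> (\<forall>j \<in> {1..<card V}. y (\<pi> j) \<ge> y (\<pi> (j + 1))) \<and> y (\<pi> (card V)) = 0"

definition lovasz_sum :: "'a set \<Rightarrow> ('a set \<Rightarrow> real) \<Rightarrow> ('a \<Rightarrow> real) \<Rightarrow> (nat \<Rightarrow> 'a) \<Rightarrow> real" where
  "lovasz_sum V f y \<pi> = (\<Sum>j \<in> {1..<card V}. (y (\<pi> j) - y (\<pi> (j + 1))) * f (\<pi> ` {1..j}))"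

text \<open>
  The Lovasz extension is meaningful only for vectors with maximum \<open>1\<close> and minimum \<open>0\<close> on \<open>V\<close>, for
  which a sorting enumeration exists. The choice of the enumeration does not matter, see
  \<open>lovasz_extension_eq\<close> below.
\<close>

definition lovasz_extension :: "'a set \<Rightarrow> ('a set \<Rightarrow> real) \<Rightarrow> ('a \<Rightarrow> real) \<Rightarrow> real" where
  "lovasz_extension V f y = lovasz_sum V f y (SOME \<pi>. sorting_enum V y \<pi>)"

definition cp_sub_ml_feasible ::
  "'a set \<Rightarrow> nat \<Rightarrow> ('a \<rightharpoonup> nat) \<Rightarrow> (nat \<Rightarrow> 'a \<Rightarrow> real) \<Rightarrow> bool" where
  "cp_sub_ml_feasible V k c y \<longleftrightarrow>
    (\<forall>v \<in> V. (\<Sum>i = 1..k. y i v) = 1) \<and>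
    (\<forall>v \<in> V. \<forall>i \<in> {1..k}. c v = Some i \<longrightarrow> y i v = 1) \<and>
    (\<forall>v \<in> V. \<forall>i \<in> {1..k}. y i v \<ge> 0)"

definition cp_sub_ml_objective ::
  "'a set \<Rightarrow> ('a set \<Rightarrow> real) \<Rightarrow> nat \<Rightarrow> (nat \<Rightarrow> 'a \<Rightarrow> real) \<Rightarrow> real" where
  "cp_sub_ml_objective V f k y = (\<Sum>i = 1..k. lovasz_extension V f (y i))"


lemma sorting_enum_antimono:
  assumes "sorting_enum V y \<pi>" "1 \<le> i" "i \<le> j" "j \<le> card V"
  shows "y (\<pi> j) \<le> y (\<pi> i)"
  using assms(3,4)
proof (induction j rule: dec_induct)
  case base
  then show ?case by simp
next
  case (step m)
  have "m \<in> {1..<card V}" using step assms(2) by auto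
  then have "y (\<pi> (m + 1)) \<le> y (\<pi> m)" using assms(1) by (auto simp: sorting_enum_def)
  with step show ?case by simp
qed

lemma sorting_enum_values_unique:
  assumes "sorting_enum V y \<pi>" "sorting_enum V y \<rho>" "j \<in> {1..card V}"
  shows "y (\<pi> j) = y (\<rho> j)"
proof -
  define vals where "vals \<sigma> = map (\<lambda>i. - y (\<sigma> i)) [1..<Suc (card V)]" for \<sigma> :: "nat \<Rightarrow> 'a"
  have s: "sorted (vals \<sigma>)" if "sorting_enum V y \<sigma>" for \<sigma>
    using sorting_enum_antimono[OF that]
    by (auto simp: vals_def sorted_iff_nth_mono nth_append simp del: upt_Suc)
  have m: "mset (vals \<sigma>) = image_mset (\<lambda>v. - y v) (mset_set V)" if "sorting_enum V y \<sigma>" for \<sigma>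
  proof -
    have b: "bij_betw \<sigma> {1..card V} V" using that by (simp add: sorting_enum_def)
    have "mset (vals \<sigma>) = image_mset (\<lambda>i. - y (\<sigma> i)) (mset_set {1..card V})"
      by (simp add: vals_def atLeastLessThanSuc_atLeastAtMost flip: mset_set_upto_eq_mset_upto
          del: upt_Suc)
    also have "\<dots> = image_mset (\<lambda>v. - y v) (image_mset \<sigma> (mset_set {1..card V}))"
      by (simp add: multiset.map_comp o_def)
    also have "image_mset \<sigma> (mset_set {1..card V}) = mset_set V"
      using b by (simp add: image_mset_mset_set bij_betw_def)
    finally show ?thesis .
  qed
  have "vals \<pi> = vals \<rho>"
    using s m assms(1,2) by (metis properties_for_sort)
  then have "vals \<pi> ! (j - 1) = vals \<rho> ! (j - 1)" by simp
  then show ?thesis using assms(3) by (auto simp: vals_def simp del: upt_Suc)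
qed

lemma sorting_enum_prefix:
  assumes "sorting_enum V y \<pi>" "j \<in> {1..<card V}" "y (\<pi> j) \<noteq> y (\<pi> (j + 1))"
  shows "\<pi> ` {1..j} = {v \<in> V. y v \<ge> y (\<pi> j)}"
proof (intro equalityI subsetI)
  fix v assume "v \<in> \<pi> ` {1..j}"
  then obtain i where i: "i \<in> {1..j}" "v = \<pi> i" by auto
  have "\<pi> i \<in> V"
    using assms(1,2) i(1) by (auto simp: sorting_enum_def bij_betw_def)
  moreover have "y (\<pi> j) \<le> y (\<pi> i)"
    using i(1) assms(2) by (intro sorting_enum_antimono[OF assms(1)]) auto
  ultimately show "v \<in> {v \<in> V. y v \<ge> y (\<pi> j)}" using i(2) by simp
next
  fix v assume v: "v \<in> {v \<in> V. y v \<ge> y (\<pi> j)}"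
  then have "v \<in> \<pi> ` {1..card V}"
    using assms(1) by (auto simp: sorting_enum_def bij_betw_def)
  then obtain i where i: "i \<in> {1..card V}" "v = \<pi> i" by auto
  have "y (\<pi> (j + 1)) < y (\<pi> j)"
    using assms sorting_enum_antimono[OF assms(1), of j "j + 1"] by force
  moreover have "y (\<pi> i) \<le> y (\<pi> (j + 1))" if "j < i"
    using that i(1) by (intro sorting_enum_antimono[OF assms(1)]) auto
  ultimately have "i \<le> j" using v i(2) by force
  with i show "v \<in> \<pi> ` {1..j}" by auto
qed

lemma lovasz_extension_eq:
  assumes "sorting_enum V y \<pi>"
  shows "lovasz_extension V f y = lovasz_sum V f y \<pi>"
proof -
  define \<rho> where "\<rho> = (SOME \<pi>. sorting_enum V y \<pi>)"
  have r: "sorting_enum V y \<rho>"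
    unfolding \<rho>_def using someI[of "sorting_enum V y", OF assms] by simp
  have "(y (\<rho> j) - y (\<rho> (j + 1))) * f (\<rho> ` {1..j}) = (y (\<pi> j) - y (\<pi> (j + 1))) * f (\<pi> ` {1..j})"
    if j: "j \<in> {1..<card V}" for j
  proof -
    have e: "y (\<rho> j) = y (\<pi> j)" "y (\<rho> (j + 1)) = y (\<pi> (j + 1))"
      using j by (auto intro!: sorting_enum_values_unique[OF r assms])
    show ?thesis
    proof (cases "y (\<pi> j) = y (\<pi> (j + 1))")
      case True
      then show ?thesis using e by simp
    next
      case False
      then show ?thesis
        using e sorting_enum_prefix[OF r j] sorting_enum_prefix[OF assms j] by simp
    qed
  qed
  then show ?thesis
    unfolding lovasz_extension_def lovasz_sum_def \<rho>_def[symmetric] by (intro sum.cong) auto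
qed

end

theory Submission
  imports Defs
begin

text \<open>
  Along a sorting enumeration of a vector, the prefixes whose boundary contains the vertex \<open>v\<close> are
  those that contain \<open>v\<close> but not the last vertex of the closed neighborhood of \<open>v\<close>. Their
  coefficients in the Lovasz sum telescope to the largest drop of the vector from \<open>v\<close> to its closed
  neighborhood, so \<open>v\<close> contributes its weight times this drop. This drop is also the smallest value
  that the linear program permits for the variable of \<open>v\<close> and the given color.
\<close>

text \<open>Inserting \<open>v\<close> keeps the set nonempty at an isolated vertex and cuts the
  drop off at 0. Thus it combines the two lower bounds on \<open>xc i v\<close> in the linear
  program: the difference constraints and nonnegativity.\<close>

definition neighborhood_drop :: "('a, 'b) pre_digraph \<Rightarrow> ('a \<Rightarrow> real) \<Rightarrow> 'a \<Rightarrow> real" where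
  "neighborhood_drop G y v = y v - Min (y ` insert v (neighbors G v))"

section \<open>Existence of sorting enumerations\<close>

lemma sorting_enum_exists:
  fixes y :: "'a \<Rightarrow> real"
  assumes fin: "finite V"
    and bounds: "\<And>v. v \<in> V \<Longrightarrow> 0 \<le> y v \<and> y v \<le> 1"
    and a: "a \<in> V" "y a = 1" and b: "b \<in> V" "y b = 0"
  obtains \<pi> where "sorting_enum V y \<pi>"
proof -
  obtain zs where zs: "set zs = V" "distinct zs" using finite_distinct_list[OF fin] by auto
  \<comment> \<open>Negated keys turn the ascending sort into a descending one; \<open>\<pi>\<close>
    then shifts list positions, which start at 0, to start at 1.\<close>
  define xs where "xs = sort_key (\<lambda>v. - y v) zs"
  define \<pi> where "\<pi> j = xs ! (j - 1)" for j
  have xs: "set xs = V" "distinct xs" "sorted (map (\<lambda>v. - y v) xs)"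
    using zs by (auto simp: xs_def)
  have len: "length xs = card V" using xs distinct_card by metis
  have antimono: "y (xs ! j) \<le> y (xs ! i)" if "i \<le> j" "j < card V" for i j
    using xs(3) that len by (auto simp: sorted_iff_nth_mono)
  have pos: "0 < card V" using a(1) fin by (auto simp: card_gt_0_iff)
  have bij: "bij_betw \<pi> {1..card V} V"
  proof -
    have "bij_betw (\<lambda>j. j - 1) {1..card V} {..<card V}"
      by (rule bij_betw_byWitness[where f' = Suc]) auto
    moreover have "bij_betw ((!) xs) {..<card V} V"
      using xs len by (intro bij_betw_nth) auto
    ultimately have "bij_betw ((!) xs \<circ> (\<lambda>j. j - 1)) {1..card V} V"
      by (rule bij_betw_trans)
    then show ?thesis by (simp add: \<pi>_def[abs_def] comp_def)
  qed
  have nth: "xs ! i \<in> V" if "i < card V" for i using that xs(1) len by auto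
  obtain i where i: "i < card V" "a = xs ! i" using a(1) xs(1) len by (metis in_set_conv_nth)
  obtain j where j: "j < card V" "b = xs ! j" using b(1) xs(1) len by (metis in_set_conv_nth)
  \<comment> \<open>The first entry is at least \<open>y a = 1\<close> and the last at most
    \<open>y b = 0\<close>; the bounds on \<open>y\<close> force equality.\<close>
  have "y (xs ! 0) = 1"
    using antimono[of 0 i] i a bounds[OF nth[of 0]] pos by auto
  moreover have "y (xs ! (card V - 1)) = 0"
    using antimono[of j "card V - 1"] j b bounds[OF nth[of "card V - 1"]] pos by auto
  moreover have "y (\<pi> (j + 1)) \<le> y (\<pi> j)" if "j \<in> {1..<card V}" for j
    using antimono[of "j - 1" j] that by (auto simp: \<pi>_def)
  ultimately have "sorting_enum V y \<pi>"
    using bij by (auto simp: sorting_enum_def \<pi>_def)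
  then show thesis by (rule that)
qed

section \<open>Neighborhood drops and the Lovasz extension\<close>

context fin_digraph
begin

lemma neighbors_subset_verts: "neighbors G v \<subseteq> verts G"
  by (auto simp: neighbors_def)

lemma finite_neighbors: "finite (neighbors G v)"
  using neighbors_subset_verts finite_verts by (rule finite_subset)

lemma neighborhood_drop_ge:
  assumes "u \<in> neighbors G v"
  shows "y v - y u \<le> neighborhood_drop G y v"
proof -
  have "Min (y ` insert v (neighbors G v)) \<le> y u"
    using assms finite_neighbors by (intro Min_le) auto
  then show ?thesis by (simp add: neighborhood_drop_def)
qed

lemma neighborhood_drop_nonneg: "0 \<le> neighborhood_drop G y v"
proof -
  have "Min (y ` insert v (neighbors G v)) \<le> y v"
    using finite_neighbors by (intro Min_le) auto
  then show ?thesis by (simp add: neighborhood_drop_def)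
qed

text \<open>The minimum is attained, either at \<open>v\<close>, where the drop is 0, or at a
  neighbor; the two hypotheses cover these cases.\<close>

lemma neighborhood_drop_le:
  assumes "0 \<le> t" "\<And>u. u \<in> neighbors G v \<Longrightarrow> y v - y u \<le> t"
  shows "neighborhood_drop G y v \<le> t"
proof -
  have "Min (y ` insert v (neighbors G v)) \<in> y ` insert v (neighbors G v)"
    using finite_neighbors by (intro Min_in) auto
  then show ?thesis using assms by (auto simp: neighborhood_drop_def)
qed

lemma sum_coefficients_boundary:
  assumes \<pi>: "sorting_enum (verts G) y \<pi>" and v: "v \<in> verts G"
  shows "(\<Sum>j \<in> {j \<in> {1..<card (verts G)}. v \<in> boundary G (\<pi> ` {1..j})}. y (\<pi> j) - y (\<pi> (j + 1)))
    = neighborhood_drop G y v"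
proof -
  let ?n = "card (verts G)"
  let ?N = "insert v (neighbors G v)"
  \<comment> \<open>\<open>I\<close> collects the positions of the closed neighborhood, so
    \<open>q\<close> is where its last vertex appears; \<open>p\<close> below is the position of
    \<open>v\<close>.\<close>
  define I where "I = {j \<in> {1..?n}. \<pi> j \<in> ?N}"
  define q where "q = Max I"
  have inj: "inj_on \<pi> {1..?n}" and img: "\<pi> ` {1..?n} = verts G"
    using \<pi> by (auto simp: sorting_enum_def bij_betw_def)
  have "v \<in> \<pi> ` {1..?n}" using v img by simp
  then obtain p where p: "p \<in> {1..?n}" "v = \<pi> p" by auto
  have pI: "p \<in> I" and finI: "finite I" using p by (auto simp: I_def)
  have qI: "q \<in> I" unfolding q_def using pI finI by (intro Max_in) auto
  have q_ge: "j \<le> q" if "j \<in> I" for j unfolding q_def using that finI by simp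
  have pq: "p \<le> q" using q_ge[OF pI] .
  have index: "\<exists>j \<in> I. u = \<pi> j" if "u \<in> ?N" for u
  proof -
    have "u \<in> verts G" using that v neighbors_subset_verts by auto
    then have "u \<in> \<pi> ` {1..?n}" using img by simp
    then obtain j where "j \<in> {1..?n}" "u = \<pi> j" by auto
    then show ?thesis using that by (auto simp: I_def)
  qed
  have mem: "\<pi> i \<in> \<pi> ` {1..j} \<longleftrightarrow> i \<le> j" if "i \<in> {1..?n}" "j \<le> ?n" for i j
  proof
    assume "\<pi> i \<in> \<pi> ` {1..j}"
    then obtain l where "l \<in> {1..j}" "\<pi> i = \<pi> l" by auto
    then show "i \<le> j" using inj_onD[OF inj, of i l] that by auto
  qed (use that in auto)
  \<comment> \<open>A prefix of length \<open>j\<close> contains \<open>v\<close> once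
    \<open>p \<le> j\<close> and misses some neighbor of \<open>v\<close> as long as
    \<open>j < q\<close>.\<close>
  have "{j \<in> {1..<?n}. v \<in> boundary G (\<pi> ` {1..j})} = {p..<q}"
  proof (intro equalityI subsetI)
    fix j assume "j \<in> {j \<in> {1..<?n}. v \<in> boundary G (\<pi> ` {1..j})}"
    then have j: "j \<in> {1..<?n}" "v \<in> \<pi> ` {1..j}"
      and "\<exists>u \<in> neighbors G v. u \<notin> \<pi> ` {1..j}"
      by (auto simp: boundary_def)
    then obtain l where l: "l \<in> I" "\<pi> l \<notin> \<pi> ` {1..j}" using index by blast
    have "j < l" using l mem[of l j] j(1) by (auto simp: I_def)
    moreover have "p \<le> j" using j mem[of p j] p by auto
    ultimately show "j \<in> {p..<q}" using q_ge[OF l(1)] by auto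
  next
    fix j assume j: "j \<in> {p..<q}"
    then have jn: "j \<in> {1..<?n}" using p(1) qI by (auto simp: I_def)
    \<comment> \<open>The interval is nonempty, so \<open>\<pi> q\<close> is not \<open>v\<close>
      itself but a genuine neighbor, and it lies outside the prefix.\<close>
    have "q \<noteq> p" using j by auto
    then have "\<pi> q \<noteq> v" using inj_onD[OF inj, of q p] p qI by (auto simp: I_def)
    then have "\<pi> q \<in> neighbors G v" using qI by (auto simp: I_def)
    moreover have "\<pi> q \<notin> \<pi> ` {1..j}" using mem[of q j] qI j jn by (auto simp: I_def)
    moreover have "v \<in> \<pi> ` {1..j}" using mem[of p j] p j jn by auto
    ultimately show "j \<in> {j \<in> {1..<?n}. v \<in> boundary G (\<pi> ` {1..j})}"
      using jn by (auto simp: boundary_def)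
  qed
  \<comment> \<open>The telescoping rule takes the later term minus the earlier one, hence the
    negated values.\<close>
  moreover have "(\<Sum>j = p..<q. y (\<pi> j) - y (\<pi> (j + 1))) = y (\<pi> p) - y (\<pi> q)"
    using sum_Suc_diff'[OF pq, of "\<lambda>j. - y (\<pi> j)"] by simp
  moreover have "Min (y ` ?N) = y (\<pi> q)"
  proof (rule Min_eqI)
    show "finite (y ` ?N)" using finite_neighbors by simp
    show "y (\<pi> q) \<in> y ` ?N" using qI by (auto simp: I_def)
    fix z assume "z \<in> y ` ?N"
    then obtain j where j: "j \<in> I" "z = y (\<pi> j)" using index by blast
    then show "y (\<pi> q) \<le> z"
      using sorting_enum_antimono[OF \<pi>, of j q] q_ge[of j] qI by (auto simp: I_def)
  qed
  ultimately show ?thesis using p(2) by (simp add: neighborhood_drop_def)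
qed

text \<open>Exchanging the sums over prefixes and over boundary vertices collects, for each vertex,
  the coefficients of the prefixes that have it on their boundary.\<close>

lemma lovasz_extension_boundary_weight:
  assumes \<pi>: "sorting_enum (verts G) y \<pi>"
  shows "lovasz_extension (verts G) (boundary_weight G w) y
    = (\<Sum>v \<in> verts G. w v * neighborhood_drop G y v)"
proof -
  let ?J = "{1..<card (verts G)}"
  let ?d = "\<lambda>j. y (\<pi> j) - y (\<pi> (j + 1))"
  let ?B = "\<lambda>j. boundary G (\<pi> ` {1..j})"
  have "\<pi> ` {1..j} \<subseteq> verts G" if "j \<in> ?J" for j
    using \<pi> that by (auto simp: sorting_enum_def bij_betw_def)
  \<comment> \<open>Written as a filter of the fixed set \<open>verts G\<close>, the inner range no
    longer blocks the exchange of sums.\<close>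
  then have B: "{v \<in> verts G. v \<in> ?B j} = ?B j" if "j \<in> ?J" for j
    using that by (fastforce simp: boundary_def)
  have "lovasz_extension (verts G) (boundary_weight G w) y
      = (\<Sum>j \<in> ?J. \<Sum>v \<in> ?B j. w v * ?d j)"
    unfolding lovasz_extension_eq[OF \<pi>] lovasz_sum_def boundary_weight_def
    by (simp add: sum_distrib_left mult.commute)
  also have "\<dots> = (\<Sum>j \<in> ?J. \<Sum>v \<in> {v \<in> verts G. v \<in> ?B j}. w v * ?d j)"
    using B by (intro sum.cong) auto
  also have "\<dots> = (\<Sum>v \<in> verts G. \<Sum>j \<in> {j \<in> ?J. v \<in> ?B j}. w v * ?d j)"
    by (rule sum.swap_restrict) auto
  also have "\<dots> = (\<Sum>v \<in> verts G. w v * neighborhood_drop G y v)"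
    unfolding sum_distrib_left[symmetric]
    using sum_coefficients_boundary[OF \<pi>] by (intro sum.cong) auto
  finally show ?thesis .
qed

lemma lp_muhv_feasible_neighborhood_drop:
  assumes "cp_sub_ml_feasible (verts G) k c y"
  shows "lp_muhv_feasible G k c y (\<lambda>i. neighborhood_drop G (y i))
    (\<lambda>v. \<Sum>i = 1..k. neighborhood_drop G (y i) v)"
  using assms neighborhood_drop_ge neighborhood_drop_nonneg
  by (auto simp: lp_muhv_feasible_def cp_sub_ml_feasible_def intro!: sum_nonneg)

text \<open>Each \<open>xc i v\<close> is nonnegative and bounds every difference to a neighbor,
  hence dominates the drop. The drops are therefore the pointwise least completion of
  \<open>y\<close>.\<close>

lemma lp_muhv_feasible_ge_neighborhood_drop:
  assumes "lp_muhv_feasible G k c y xc x" "v \<in> verts G"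
  shows "(\<Sum>i = 1..k. neighborhood_drop G (y i) v) \<le> x v"
proof -
  have "(\<Sum>i = 1..k. neighborhood_drop G (y i) v) \<le> (\<Sum>i = 1..k. xc i v)"
    using assms by (intro sum_mono neighborhood_drop_le) (auto simp: lp_muhv_feasible_def)
  then show ?thesis using assms by (simp add: lp_muhv_feasible_def)
qed

end

lemma lp_muhv_feasible_imp_cp_sub_ml_feasible:
  "lp_muhv_feasible G k c y xc x \<Longrightarrow> cp_sub_ml_feasible (verts G) k c y"
  by (auto simp: lp_muhv_feasible_def cp_sub_ml_feasible_def)

section \<open>Comparison of the objectives for an instance\<close>

context muhv_instance
begin

text \<open>The value 1 is attained at a vertex precolored \<open>i\<close>. The value 0 is attained
  at a vertex precolored with a second color, which exhausts the unit sum there.\<close>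

lemma sorting_enum_color:
  assumes "k \<ge> 2" and feas: "cp_sub_ml_feasible (verts G) k c y" and i: "i \<in> {1..k}"
  obtains \<pi> where "sorting_enum (verts G) (y i) \<pi>"
proof -
  have total: "(\<Sum>i = 1..k. y i v) = 1" and nonneg: "\<And>i. i \<in> {1..k} \<Longrightarrow> 0 \<le> y i v"
    if "v \<in> verts G" for v
    using feas that by (auto simp: cp_sub_ml_feasible_def)
  have colored: "\<exists>v \<in> verts G. y j v = 1" if j: "j \<in> {1..k}" for j
  proof -
    have "j \<in> ran c" using j ran_coloring by simp
    then obtain v where "c v = Some j" by (auto simp: ran_def)
    moreover from this have "v \<in> verts G" using dom_coloring by auto
    ultimately show ?thesis using feas j unfolding cp_sub_ml_feasible_def by blast
  qed
  \<comment> \<open>Any color other than \<open>i\<close> would do; \<open>k \<ge> 2\<close> puts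
    this one in range.\<close>
  define j where "j = (if i = 1 then 2 else 1 :: nat)"
  have j: "j \<in> {1..k}" "j \<noteq> i" using \<open>k \<ge> 2\<close> by (auto simp: j_def)
  \<comment> \<open>Two of the nonnegative summands cannot exceed the total 1. This yields both the
    upper bound on \<open>y i\<close> and its zero at \<open>b\<close>.\<close>
  have pair: "y i v + y j v \<le> 1" if v: "v \<in> verts G" for v
  proof -
    have "(\<Sum>l \<in> {i, j}. y l v) \<le> (\<Sum>l = 1..k. y l v)"
      using i j nonneg[OF v] by (intro sum_mono2) auto
    then show ?thesis using total[OF v] j(2) by simp
  qed
  obtain a where a: "a \<in> verts G" "y i a = 1" using colored[OF i] by auto
  obtain b where b: "b \<in> verts G" "y j b = 1" using colored[OF j(1)] by auto
  have "y i b = 0" using pair[OF b(1)] b nonneg[OF b(1) i] by simp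
  moreover have "0 \<le> y i v \<and> y i v \<le> 1" if "v \<in> verts G" for v
    using pair[OF that] nonneg[OF that i] nonneg[OF that j(1)] by simp
  ultimately show thesis
    using sorting_enum_exists[of "verts G" "y i" a b] a b(1) that by auto
qed

lemma cp_sub_ml_objective_eq:
  assumes "k \<ge> 2" "cp_sub_ml_feasible (verts G) k c y"
  shows "cp_sub_ml_objective (verts G) (boundary_weight G w) k y
    = lp_muhv_objective G w (\<lambda>v. \<Sum>i = 1..k. neighborhood_drop G (y i) v)"
proof -
  have "cp_sub_ml_objective (verts G) (boundary_weight G w) k y
      = (\<Sum>i = 1..k. \<Sum>v \<in> verts G. w v * neighborhood_drop G (y i) v)"
    unfolding cp_sub_ml_objective_def
  proof (intro sum.cong refl)
    fix i assume "i \<in> {1..k}"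
    then obtain \<pi> where "sorting_enum (verts G) (y i) \<pi>"
      using sorting_enum_color assms by blast
    then show "lovasz_extension (verts G) (boundary_weight G w) (y i)
        = (\<Sum>v \<in> verts G. w v * neighborhood_drop G (y i) v)"
      by (rule lovasz_extension_boundary_weight)
  qed
  also have "\<dots> = lp_muhv_objective G w (\<lambda>v. \<Sum>i = 1..k. neighborhood_drop G (y i) v)"
    unfolding lp_muhv_objective_def sum_distrib_left by (rule sum.swap)
  finally show ?thesis .
qed

text \<open>Nonnegative weights carry the pointwise minimality of the drops over to the
  objective.\<close>

lemma lp_muhv_objective_ge:
  assumes "lp_muhv_feasible G k c y xc x"
  shows "lp_muhv_objective G w (\<lambda>v. \<Sum>i = 1..k. neighborhood_drop G (y i) v)
    \<le> lp_muhv_objective G w x"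
  unfolding lp_muhv_objective_def
  using lp_muhv_feasible_ge_neighborhood_drop[OF assms] weight_nonneg
  by (intro sum_mono mult_left_mono) auto

end

theorem theorem10:
  fixes G :: "('a, 'b) pre_digraph" and w :: "'a \<Rightarrow> real" and k :: nat and c :: "'a \<rightharpoonup> nat"
  assumes "k \<ge> 2" and "muhv_instance G w k c"
  shows "(\<forall>y. (\<exists>xc x. lp_muhv_feasible G k c y xc x) \<longleftrightarrow> cp_sub_ml_feasible (verts G) k c y) \<and>
    (\<forall>y. cp_sub_ml_feasible (verts G) k c y \<longrightarrow>
      (\<exists>xc x. lp_muhv_feasible G k c y xc x \<and>
        lp_muhv_objective G w x = cp_sub_ml_objective (verts G) (boundary_weight G w) k y) \<and>
      (\<forall>xc x. lp_muhv_feasible G k c y xc x \<longrightarrow>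
        cp_sub_ml_objective (verts G) (boundary_weight G w) k y \<le> lp_muhv_objective G w x))"
proof -
  interpret muhv_instance G w k c by (rule assms(2))
  \<comment> \<open>The drops are the witness twice: they complete a feasible \<open>y\<close> to a
    feasible point of the linear program, and they attain the minimum.\<close>
  show ?thesis
    using lp_muhv_feasible_imp_cp_sub_ml_feasible lp_muhv_feasible_neighborhood_drop
      cp_sub_ml_objective_eq[OF \<open>k \<ge> 2\<close>] lp_muhv_objective_ge
    by metis
qed

end
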